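(* Fix $\alpha>0$. Let the divisor $X=\{(\lambda,m_\lambda)\}_{\lambda\in\Lambda}$ be such that for every $C>0$ there exists a compact subset $K$ of $\mathbb C$ satisfying $$\bigcup_{\lambda\in\Lambda,\ m_\lambda>\alpha C^2} D(\lambda,\sqrt{m_\lambda/\alpha}-C)=\mathbb C\setminus K.$$ Then we can find a subset $\Lambda'$ of $\Lambda$ such that for every $C>0$ there is a compact subset $K$ of $\mathbb C$ satisfying $$\bigcup_{\lambda\in\Lambda',\ m_\lambda>\alpha C^2} D(\lambda,\sqrt{m_\lambda/\alpha}-C)=\mathbb C\setminus K,$$ and $$\lim_{\lambda\in\Lambda',\ |\lambda|\to\infty}m_\lambda=+\infty.$$
   Context: $D(z,r)$ is the open disc of radius $r$ centered at $z\in\mathbb C$. A divisor is $X=\{(\lambda,m_\lambda)\}_{\lambda\in\Lambda}$, where $\Lambda$ is a sequence of (distinct) points in $\mathbb C$ and $m_\lambda\in\{1,2,3,\dots\}$ is the multiplicity associated with $\lambda$. The last limit means: for every $M$ there is $R$ such that $m_\lambda>M$ for all $\lambda\in\Lambda'$ with $|\lambda|>R$. *)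

theory Defs
  imports "HOL-Analysis.Analysis"
begin

text \<open>A divisor is encoded by its support \<open>L\<close>, a countable set (the points of the sequence are
  distinct), together with a multiplicity function \<open>m\<close> of which only the values on \<open>L\<close> matter.\<close>

definition divisor :: "complex set \<Rightarrow> (complex \<Rightarrow> nat) \<Rightarrow> bool"
  where "divisor L m \<longleftrightarrow> countable L \<and> (\<forall>w\<in>L. 1 \<le> m w)"

definition disc_union :: "real \<Rightarrow> complex set \<Rightarrow> (complex \<Rightarrow> nat) \<Rightarrow> real \<Rightarrow> complex set"
  where "disc_union \<alpha> L m C =
    (\<Union>w\<in>{w \<in> L. real (m w) > \<alpha> * C\<^sup>2}. ball w (sqrt (real (m w) / \<alpha>) - C))"

end

theory Submission
  imports Defs
begin

text \<open>Put \<open>r w = sqrt (m w / \<alpha>)\<close> and let \<open>R n\<close> be such that the discs of radius \<open>r w - (n + 1)\<close> cover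
  \<open>cmod z > R n\<close>. Keep a point \<open>w\<close> only if, for some \<open>n\<close>, its disc of radius \<open>r w - (n + 1)\<close> meets
  \<open>cmod z \<le> R (n + 1)\<close>. If \<open>R n < cmod z \<le> R (n + 1)\<close>, the disc covering \<open>z\<close> at level \<open>n\<close> is kept, so
  the covering property survives. A kept point with \<open>r w\<close> bounded can only come from the
  finitely many levels \<open>n < r w\<close>, hence lies in a bounded set.\<close>

text \<open>A disc containing a point has positive radius, so
  \<open>C < sqrt (m w / \<alpha>)\<close>; as \<open>C \<ge> 0\<close>, squaring yields the side
  condition on \<open>m w\<close>.\<close>

lemma mem_disc_union_iff:
  assumes "\<alpha> > 0" "C \<ge> 0"
  shows "z \<in> disc_union \<alpha> L m C \<longleftrightarrow> (\<exists>w\<in>L. dist w z < sqrt (real (m w) / \<alpha>) - C)"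
proof -
  have "real (m w) > \<alpha> * C\<^sup>2" if "dist w z < sqrt (real (m w) / \<alpha>) - C" for w
  proof -
    have "C < sqrt (real (m w) / \<alpha>)"
      using that zero_le_dist[of w z] by linarith
    then have "C\<^sup>2 < real (m w) / \<alpha>"
      using assms(2) real_less_rsqrt real_sqrt_less_iff by (metis abs_of_nonneg real_sqrt_abs)
    then show ?thesis
      using assms(1) by (simp add: pos_less_divide_eq mult.commute)
  qed
  then show ?thesis
    unfolding disc_union_def by auto
qed

lemma open_disc_union: "open (disc_union \<alpha> L m C)"
  unfolding disc_union_def by auto

text \<open>The union is open, so its complement is closed, and compactness reduces to
  boundedness.\<close>

lemma disc_union_cocompact_iff:
  "(\<exists>K. compact K \<and> disc_union \<alpha> L m C = - K) \<longleftrightarrow>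
    (\<exists>R. \<forall>z. cmod z > R \<longrightarrow> z \<in> disc_union \<alpha> L m C)" (is "?lhs \<longleftrightarrow> ?rhs")
proof
  assume ?lhs
  then obtain K where K: "compact K" "disc_union \<alpha> L m C = - K" by blast
  then obtain R where "\<forall>z\<in>K. cmod z \<le> R"
    using compact_imp_bounded bounded_iff by metis
  then show ?rhs
    using K(2) by (metis ComplI not_le)
next
  assume ?rhs
  then have "bounded (- disc_union \<alpha> L m C)"
    unfolding bounded_iff by (metis ComplD not_le)
  then have "compact (- disc_union \<alpha> L m C)"
    using open_disc_union by (simp add: compact_eq_bounded_closed closed_Compl)
  then show ?lhs
    by (metis double_complement)
qed

theorem proposition1p2:
  fixes \<alpha> :: real and \<Lambda> :: "complex set" and m :: "complex \<Rightarrow> nat"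
  assumes "\<alpha> > 0"
    and "divisor \<Lambda> m"
    and "\<forall>C>0. \<exists>K. compact K \<and> disc_union \<alpha> \<Lambda> m C = - K"
  shows "\<exists>\<Lambda>'. \<Lambda>' \<subseteq> \<Lambda> \<and>
           (\<forall>C>0. \<exists>K. compact K \<and> disc_union \<alpha> \<Lambda>' m C = - K) \<and>
           (\<forall>M::real. \<exists>R::real. \<forall>w\<in>\<Lambda>'. cmod w > R \<longrightarrow> real (m w) > M)"
proof -
  define r where "r w = sqrt (real (m w) / \<alpha>)" for w
  \<comment> \<open>The shift to \<open>Suc n\<close> keeps the level positive at
    \<open>n = 0\<close>. Requiring \<open>R \<ge> n\<close> makes the radii tend to infinity, so
    every \<open>z\<close> is eventually enclosed.\<close>
  have "\<exists>R \<ge> real n. \<forall>z. cmod z > R \<longrightarrow> (\<exists>w\<in>\<Lambda>. dist w z < r w - real (Suc n))" for n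
  proof -
    obtain R where "\<forall>z. cmod z > R \<longrightarrow> z \<in> disc_union \<alpha> \<Lambda> m (real (Suc n))"
      using assms(3) unfolding disc_union_cocompact_iff by (metis of_nat_0_less_iff zero_less_Suc)
    then show ?thesis
      using mem_disc_union_iff[OF assms(1), of "real (Suc n)"]
      by (intro exI[of _ "max R (real n)"]) (simp add: r_def)
  qed
  then obtain R where R_ge: "\<And>n. R n \<ge> real n"
    and R: "\<And>n z. cmod z > R n \<Longrightarrow> \<exists>w\<in>\<Lambda>. dist w z < r w - real (Suc n)"
    by metis
  define \<Lambda>' where
    "\<Lambda>' = {w \<in> \<Lambda>. \<exists>n z. dist w z < r w - real (Suc n) \<and> cmod z \<le> R (Suc n)}"
  have "\<exists>K. compact K \<and> disc_union \<alpha> \<Lambda>' m C = - K" if "C > 0" for C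
  proof -
    obtain N where N: "C \<le> real N"
      using real_arch_simple by blast
    have "z \<in> disc_union \<alpha> \<Lambda>' m C" if z: "cmod z > R N" for z
    proof -
      obtain k where "cmod z \<le> real k"
        using real_arch_simple by blast
      with z R_ge[of N] have "cmod z \<le> R k" "N \<le> k"
        using R_ge[of k] by linarith+
      \<comment> \<open>\<open>R\<close> need not be monotone: going from \<open>N\<close> up to
        \<open>k\<close>, the value of \<open>R\<close> must somewhere pass from below
        \<open>cmod z\<close> to at least \<open>cmod z\<close>.\<close>
      from this(2,1) z obtain n where n: "N \<le> n" "cmod z > R n" "cmod z \<le> R (Suc n)"
        by (induction k rule: dec_induct) (auto simp: not_le[symmetric])
      from R[OF n(2)] obtain w where w: "w \<in> \<Lambda>" "dist w z < r w - real (Suc n)" by blast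
      then have "w \<in> \<Lambda>'"
        using n(3) unfolding \<Lambda>'_def by blast
      moreover have "dist w z < r w - C"
        using w(2) N n(1) by simp
      ultimately show ?thesis
        using mem_disc_union_iff[OF assms(1), of C] \<open>C > 0\<close> by (auto simp: r_def)
    qed
    then show ?thesis
      unfolding disc_union_cocompact_iff by blast
  qed
  moreover have "\<exists>B::real. \<forall>w\<in>\<Lambda>'. cmod w > B \<longrightarrow> real (m w) > M" for M :: real
  proof -
    define s where "s = sqrt (M / \<alpha>)"
    obtain N where N: "s \<le> real N"
      using real_arch_simple by blast
    \<comment> \<open>The first term bounds \<open>cmod z\<close> for a witness \<open>z\<close> of
      \<open>w \<in> \<Lambda>'\<close>, since its level satisfies \<open>Suc n < N\<close>; the
      second bounds \<open>dist w z < r w \<le> s\<close>.\<close>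
    define B where "B = Max (R ` {..N}) + s"
    have "cmod w \<le> B" if w: "w \<in> \<Lambda>'" and "real (m w) \<le> M" for w
    proof -
      from w obtain n z where nz: "dist w z < r w - real (Suc n)" "cmod z \<le> R (Suc n)"
        unfolding \<Lambda>'_def by blast
      have rs: "r w \<le> s"
        unfolding r_def s_def using \<open>real (m w) \<le> M\<close> assms(1) by (simp add: divide_right_mono)
      have "real (Suc n) < real N"
        using nz(1) rs N zero_le_dist[of w z] by linarith
      then have "R (Suc n) \<le> Max (R ` {..N})"
        by (intro Max_ge) auto
      moreover have "cmod w \<le> cmod z + dist w z"
        using norm_triangle_sub[of w z] by (simp add: dist_norm)
      ultimately show ?thesis
        using nz rs unfolding B_def by linarith
    qed
    then show ?thesis
      by (metis not_le)
  qed
  moreover have "\<Lambda>' \<subseteq> \<Lambda>"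
    unfolding \<Lambda>'_def by blast
  ultimately show ?thesis
    by blast
qed

end
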